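(* Let $0<\alpha<1$ and let $R$ be an $\alpha$-walk. For $n\ge1$ let $A_n$ be the discrete Cantor set $$A_n=\bigl\{\,i\in\{0,\dots,3^n-1\}:\ \lfloor i/3^j\rfloor\not\equiv1\pmod 3\ \text{ for all } j=0,\dots,n-1\,\bigr\}.$$ Then there is a constant $c>0$, depending only on the law of $R$, such that for all $n\ge1$ $$\operatorname{Cap}A_n\ge \frac{c}{n}\min\{2^n,3^{n(1-\alpha)}\}.$$ Further, if $\alpha\ne1-\log_3 2$, then there is a constant $c>0$, depending only on $\alpha$ and the law of $R$, such that for all $n\ge1$ $$\operatorname{Cap}A_n\ge c\,\min\{2^n,3^{n(1-\alpha)}\}.$$
   Context: An $\alpha$-walk ($0<\alpha<1$) is a symmetric random walk on $\mathbb{Z}$ for which there are constants $0<c_0<C_0<\infty$ with $c_0|x|^{-1-\alpha}\le\mathbb{P}_0(R_1=x)\le C_0|x|^{-1-\alpha}$ for all $x\ne0$. With $T_A=\inf\{n>0:R_n\in A\}$ and $E_A(x)=\mathbb{P}_x(T_A=\infty)$, the capacity of a finite set $A$ with respect to $R$ is $\operatorname{Cap}(A)=\sum_{a\in A}E_A(a)$. *)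

theory Defs
  imports "HOL-Probability.Probability" "HOL-Number_Theory.Cong"
begin

text \<open>
  A random walk on the integers is given by its step law, a pmf on the integers.
  Its law on trajectories when started at \<open>x\<close> is the law of the partial sums of
  independent steps; in particular the probability, starting from 0, of being at \<open>y\<close> at time 1
  is \<open>pmf p y\<close> (lemma \<open>walk_law_first_step\<close>).
\<close>

definition walk_law :: "int pmf \<Rightarrow> int \<Rightarrow> (nat \<Rightarrow> int) measure" where
  "walk_law p x =
     distr (PiM UNIV (\<lambda>_::nat. measure_pmf p)) (PiM UNIV (\<lambda>_::nat. count_space UNIV))
       (\<lambda>\<xi> n. x + (\<Sum>i<n. \<xi> i))"

definition alpha_walk :: "real \<Rightarrow> int pmf \<Rightarrow> bool" where
  "alpha_walk \<alpha> p \<longleftrightarrow>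
     0 < \<alpha> \<and> \<alpha> < 1 \<and>
     (\<forall>x. pmf p (- x) = pmf p x) \<and>
     (\<exists>c\<^sub>0 C\<^sub>0. 0 < c\<^sub>0 \<and> c\<^sub>0 < C\<^sub>0 \<and>
        (\<forall>x. x \<noteq> 0 \<longrightarrow>
           c\<^sub>0 * \<bar>real_of_int x\<bar> powr (- 1 - \<alpha>) \<le> pmf p x \<and>
           pmf p x \<le> C\<^sub>0 * \<bar>real_of_int x\<bar> powr (- 1 - \<alpha>)))"

definition hitting_time :: "int set \<Rightarrow> (nat \<Rightarrow> int) \<Rightarrow> enat" where
  "hitting_time A R = Inf (enat ` {n. 0 < n \<and> R n \<in> A})"

definition escape_prob :: "int pmf \<Rightarrow> int set \<Rightarrow> int \<Rightarrow> real" where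
  "escape_prob p A x =
     measure (walk_law p x) {R \<in> space (walk_law p x). hitting_time A R = \<infinity>}"

definition walk_capacity :: "int pmf \<Rightarrow> int set \<Rightarrow> real" where
  "walk_capacity p A = (\<Sum>a\<in>A. escape_prob p A a)"

text \<open>On integers, \<open>i div 3 ^ j\<close> is the floor of the quotient.\<close>

definition cantor_set :: "nat \<Rightarrow> int set" where
  "cantor_set n =
     {i \<in> {0..3 ^ n - 1}. \<forall>j\<in>{0..<n}. \<not> [i div 3 ^ j = 1] (mod 3)}"

lemma measurable_partial_sums:
  "(\<lambda>\<xi> n. x + (\<Sum>i<n. \<xi> i)) \<in>
     measurable (PiM UNIV (\<lambda>_::nat. measure_pmf p)) (PiM UNIV (\<lambda>_::nat. count_space (UNIV :: int set)))"
proof -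
  have s: "(\<lambda>\<xi>. x + (\<Sum>i<n. \<xi> i)) \<in>
      measurable (PiM UNIV (\<lambda>_::nat. measure_pmf p)) (count_space (UNIV :: int set))" for n
  proof (induction n arbitrary: x)
    case (Suc n)
    have c: "(\<lambda>\<xi>. \<xi> n) \<in>
        measurable (PiM UNIV (\<lambda>_::nat. measure_pmf p)) (count_space (UNIV :: int set))"
      using measurable_component_singleton[of n UNIV "\<lambda>_. measure_pmf p"]
      by (simp cong: measurable_cong_sets)
    have "(\<lambda>\<xi>. (x + (\<Sum>i<n. \<xi> i)) + \<xi> n) \<in>
        measurable (PiM UNIV (\<lambda>_::nat. measure_pmf p)) (count_space (UNIV :: int set))"
      by (rule measurable_compose_countable[OF _ c, where f = "\<lambda>k \<xi>. (x + (\<Sum>i<n. \<xi> i)) + k"])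
         (rule measurable_compose[OF Suc.IH], simp)
    then show ?case by (simp add: add.assoc)
  qed simp
  show ?thesis
    by (rule measurable_PiM_single') (use s in \<open>auto simp: PiE_def\<close>)
qed

lemma prob_space_walk_law: "prob_space (walk_law p x)"
proof -
  interpret product_prob_space "\<lambda>_::nat. measure_pmf p" UNIV ..
  show ?thesis
    unfolding walk_law_def by (rule prob_space_distr[OF measurable_partial_sums])
qed

lemma space_walk_law [simp]: "space (walk_law p x) = UNIV"
  by (simp add: walk_law_def space_PiM PiE_def)

lemma walk_law_first_step: "measure (walk_law p 0) {R. R 1 = y} = pmf p y"
proof -
  interpret product_prob_space "\<lambda>_::nat. measure_pmf p" UNIV ..
  let ?P = "PiM UNIV (\<lambda>_::nat. measure_pmf p)"
  have "{R :: nat \<Rightarrow> int. R 1 = y} = (\<lambda>R. R 1) -` {y} \<inter> space (PiM UNIV (\<lambda>_::nat. count_space (UNIV::int set)))"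
    by (auto simp: space_PiM)
  also have "\<dots> \<in> sets (PiM UNIV (\<lambda>_::nat. count_space (UNIV::int set)))"
    by (rule measurable_sets[OF measurable_component_singleton]) auto
  finally have "measure (walk_law p 0) {R. R 1 = y} =
      measure ?P ((\<lambda>\<xi>. \<xi> 0) -` {y} \<inter> space ?P)"
    unfolding walk_law_def
    by (subst measure_distr[OF measurable_partial_sums]) (auto intro!: arg_cong[where f = "measure ?P"])
  also have "\<dots> = measure (distr ?P (measure_pmf p) (\<lambda>\<xi>. \<xi> 0)) {y}"
    by (subst measure_distr) auto
  also have "\<dots> = pmf p y"
    by (subst PiM_component) (auto simp: measure_pmf_single)
  finally show ?thesis .
qed

lemma hitting_time_infinite_iff: "hitting_time A R = \<infinity> \<longleftrightarrow> (\<forall>n>0. R n \<notin> A)"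
proof -
  have "hitting_time A R = \<infinity> \<longleftrightarrow> (\<forall>t\<in>enat ` {n. 0 < n \<and> R n \<in> A}. t = top)"
    unfolding hitting_time_def top_enat_def[symmetric] by (rule Inf_top_conv)
  also have "\<dots> \<longleftrightarrow> (\<forall>n>0. R n \<notin> A)"
    unfolding top_enat_def by blast
  finally show ?thesis .
qed

lemma escape_event_measurable: "{R. hitting_time A R = \<infinity>} \<in> sets (walk_law p x)"
proof -
  let ?M = "PiM UNIV (\<lambda>_::nat. count_space (UNIV::int set))"
  have "(\<lambda>R. R n) -` (- A) \<inter> space ?M \<in> sets ?M" for n :: nat
    by (rule measurable_sets[OF measurable_component_singleton]) auto
  then have "(\<Inter>n\<in>{0<..}. (\<lambda>R. R n) -` (- A) \<inter> space ?M) \<in> sets ?M"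
    by (intro sets.countable_INT) auto
  also have "(\<Inter>n\<in>{0<..}. (\<lambda>R. R n) -` (- A) \<inter> space ?M) = {R. hitting_time A R = \<infinity>}"
    by (auto simp: hitting_time_infinite_iff space_PiM)
  finally show ?thesis by (simp add: walk_law_def)
qed

end

theory Submission imports Defs begin

text \<open>
  Let \<open>u\<close> be the probability of hitting \<open>A\<close> by time \<open>N\<close>. It is summable, equals 1 on \<open>A\<close> and
  satisfies \<open>u \<le> Pu\<close> off \<open>A\<close>, so its Dirichlet form is at most the sum over \<open>a \<in> A\<close> of the
  probability that the walk started at \<open>a\<close> does not return to \<open>A\<close> by time \<open>N + 1\<close>; as \<open>N\<close> grows
  this sum tends to the capacity. Only the lower bound on the step law is needed: up to a constant
  the Dirichlet form dominates the hierarchical form that charges \<open>3 powr (- k * (1 + \<alpha>))\<close> to each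
  pair of points in a common triadic block of side \<open>3 ^ k\<close>. Telescoping \<open>u a\<close>, for \<open>a\<close> in the
  Cantor set, along its means over the blocks containing \<open>a\<close>, and applying Cauchy--Schwarz with the
  weight \<open>2 ^ min k n * 3 powr (k * (\<alpha> - 1))\<close> at level \<open>k\<close>, gives
  \<open>2 ^ n \<le> C * (\<Sum>k\<le>n. r ^ k) * Cap\<close> with \<open>r = 2 * 3 powr (\<alpha> - 1)\<close>, and \<open>r = 1\<close> exactly in the
  critical case \<open>\<alpha> = 1 - log 3 2\<close>.
\<close>

section \<open>Hitting probabilities at finite times\<close>

definition step_space :: "int pmf \<Rightarrow> (nat \<Rightarrow> int) measure" where
  "step_space p = PiM UNIV (\<lambda>_. measure_pmf p)"

text \<open>The recursion conditions on the first step, and time 0 counts as a hit, so the value on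
  \<open>A\<close> is 1. The link with the walk itself is
  \<open>emeasure_avoid_event\<close>.\<close>

primrec hit_prob :: "int pmf \<Rightarrow> int set \<Rightarrow> nat \<Rightarrow> int \<Rightarrow> real" where
  "hit_prob p A 0 x = indicator A x"
| "hit_prob p A (Suc N) x =
     (if x \<in> A then 1 else measure_pmf.expectation p (\<lambda>y. hit_prob p A N (x + y)))"

lemma hit_prob_bounds: "0 \<le> hit_prob p A N x \<and> hit_prob p A N x \<le> 1"
proof (induction N arbitrary: x)
  case (Suc N)
  have "measure_pmf.expectation p (\<lambda>y. hit_prob p A N (x + y)) \<le> 1"
    by (rule measure_pmf.integral_le_const)
      (use Suc in \<open>auto intro!: measure_pmf.integrable_const_bound[where B = 1]\<close>)
  then show ?case using Suc by (auto intro!: integral_nonneg_AE)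
qed auto

lemma integrable_hit_prob: "integrable (measure_pmf p) (\<lambda>y. hit_prob p A N (x + y))"
  using hit_prob_bounds by (auto intro!: measure_pmf.integrable_const_bound[where B = 1])

lemma hit_prob_on: "x \<in> A \<Longrightarrow> hit_prob p A N x = 1"
  by (cases N) auto

text \<open>Off \<open>A\<close> the right side is the one-step average of
  \<open>hit_prob p A N\<close>, so monotonicity in time is exactly the subharmonicity that the
  Dirichlet form bound asks for.\<close>

lemma hit_prob_mono_Suc: "hit_prob p A N x \<le> hit_prob p A (Suc N) x"
proof (induction N arbitrary: x)
  case 0
  then show ?case using hit_prob_bounds[of p A "Suc 0" x] by (auto simp: indicator_def)
next
  case (Suc N)
  show ?case
    unfolding hit_prob.simps(2)[of p A "Suc N"] hit_prob.simps(2)[of p A N x]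
    using Suc integrable_hit_prob[of p A "Suc N" x] integrable_hit_prob[of p A N x]
    by (auto intro!: integral_mono)
qed

definition avoid_event :: "int set \<Rightarrow> nat \<Rightarrow> int \<Rightarrow> (nat \<Rightarrow> int) set" where
  "avoid_event A N x = {\<xi>. \<forall>n\<le>N. x + (\<Sum>i<n. \<xi> i) \<notin> A}"

lemma prob_space_step_space: "prob_space (step_space p)"
  unfolding step_space_def by (intro prob_space_PiM measure_pmf.prob_space_axioms)

lemma space_step_space [simp]: "space (step_space p) = UNIV"
  by (auto simp: step_space_def space_PiM)

lemma position_event_measurable:
  "{\<xi>. x + (\<Sum>i<n. \<xi> i) \<notin> A} \<in> sets (step_space p)"
proof -
  have "(\<lambda>\<xi>. x + (\<Sum>i<n. \<xi> i)) \<in> measurable (step_space p) (count_space UNIV)"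
    using measurable_compose[OF measurable_partial_sums[of x p]
        measurable_component_singleton[of n UNIV "\<lambda>_. count_space (UNIV :: int set)"]]
    by (simp add: step_space_def)
  from measurable_sets[OF this, of "- A"] show ?thesis
    by (simp add: vimage_def)
qed

lemma avoid_event_measurable: "avoid_event A N x \<in> sets (step_space p)"
proof -
  have "(\<Inter>n\<in>{..N}. {\<xi>. x + (\<Sum>i<n. \<xi> i) \<notin> A}) \<in> sets (step_space p)"
    by (intro sets.finite_INT position_event_measurable) auto
  also have "(\<Inter>n\<in>{..N}. {\<xi>. x + (\<Sum>i<n. \<xi> i) \<notin> A}) = avoid_event A N x"
    by (auto simp: avoid_event_def)
  finally show ?thesis .
qed

text \<open>A first increment and an independent fresh sequence, glued by \<open>case_nat\<close>,
  have the law of the whole sequence (\<open>PiM_iter\<close>); the rest is Fubini. This is the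
  Markov property at time 1.\<close>

lemma emeasure_step_space_first_step:
  assumes E: "E \<in> sets (step_space p)"
  shows "emeasure (step_space p) E =
    (\<integral>\<^sup>+ y. emeasure (step_space p) {\<xi>. case_nat y \<xi> \<in> E} \<partial>measure_pmf p)"
proof -
  interpret sequence_space "measure_pmf p" ..
  interpret prob_space "step_space p" by (rule prob_space_step_space)
  have S: "S = step_space p" by (simp add: step_space_def)
  have meas: "(\<lambda>(s, \<omega>). case_nat s \<omega>) \<in> measurable (measure_pmf p \<Otimes>\<^sub>M S) S"
    by (simp add: measurable_split_conv)
  have "emeasure (step_space p) E = emeasure (distr (measure_pmf p \<Otimes>\<^sub>M S) S (\<lambda>(s, \<omega>). case_nat s \<omega>)) E"
    unfolding PiM_iter unfolding S ..
  also have "\<dots> = emeasure (measure_pmf p \<Otimes>\<^sub>M S) ((\<lambda>(s, \<omega>). case_nat s \<omega>) -` E \<inter> space (measure_pmf p \<Otimes>\<^sub>M S))"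
    using E meas by (subst emeasure_distr) (auto simp: S)
  also have "\<dots> = (\<integral>\<^sup>+ y. emeasure S (Pair y -` ((\<lambda>(s, \<omega>). case_nat s \<omega>) -` E \<inter> space (measure_pmf p \<Otimes>\<^sub>M S))) \<partial>measure_pmf p)"
    using E meas by (intro P.emeasure_pair_measure_alt measurable_sets) (auto simp: S)
  finally show ?thesis
    by (simp add: S space_pair_measure vimage_def)
qed

lemma sum_case_nat: "(\<Sum>i<Suc n. case_nat y \<xi> i) = (y :: int) + (\<Sum>i<n. \<xi> i)"
  by (subst sum.lessThan_Suc_shift) simp

lemma emeasure_avoid_event: "emeasure (step_space p) (avoid_event A N x) = ennreal (1 - hit_prob p A N x)"
proof (induction N arbitrary: x)
  case 0
  interpret prob_space "step_space p" by (rule prob_space_step_space)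
  show ?case using emeasure_space_1 by (auto simp: avoid_event_def indicator_def)
next
  case (Suc N)
  show ?case
  proof (cases "x \<in> A")
    case True
    then have "avoid_event A (Suc N) x = {}"
      unfolding avoid_event_def by fastforce
    with True show ?thesis by simp
  next
    case False
    \<comment> \<open>Since \<open>x\<close> is off \<open>A\<close>, time 0 imposes nothing, and
      the conditions at times 1 to \<open>Suc N\<close> are those at times 0 to \<open>N\<close> for
      the walk restarted at \<open>x + y\<close>.\<close>
    have eq: "{\<xi>. case_nat y \<xi> \<in> avoid_event A (Suc N) x} = avoid_event A N (x + y)" for y
    proof -
      have "(\<forall>n\<le>Suc N. Q n) \<longleftrightarrow> Q 0 \<and> (\<forall>n\<le>N. Q (Suc n))" for Q
        by (metis le0 not0_implies_Suc Suc_le_mono)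
      then show ?thesis unfolding avoid_event_def mem_Collect_eq
        using False by (auto simp: sum_case_nat add.assoc simp del: sum.lessThan_Suc)
    qed
    show ?thesis
      using hit_prob_bounds[of p A N] integrable_hit_prob[of p A N x] False
      by (subst emeasure_step_space_first_step[OF avoid_event_measurable])
        (simp add: eq Suc nn_integral_eq_integral Bochner_Integration.integral_diff)
  qed
qed

text \<open>The term for \<open>N\<close> is the probability of staying off \<open>A\<close> at
  times 1 to \<open>N + 1\<close>. These events decrease to the escape event, so continuity from
  above applies.\<close>

lemma escape_prob_limit:
  "(\<lambda>N. 1 - measure_pmf.expectation p (\<lambda>y. hit_prob p A N (x + y))) \<longlonglongrightarrow> escape_prob p A x"
proof -
  interpret prob_space "step_space p" by (rule prob_space_step_space)
  \<comment> \<open>Time 0 is left out because escape is measured from points of \<open>A\<close>;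
    the range ends at \<open>Suc N\<close> so that exactly \<open>avoid_event A N\<close> remains
    after the first step.\<close>
  define E where "E N = {\<xi>. \<forall>n\<in>{1..Suc N}. x + (\<Sum>i<n. \<xi> i) \<notin> A}" for N
  have eq: "{\<xi>. case_nat y \<xi> \<in> E N} = avoid_event A N (x + y)" for y N
  proof -
    have "(\<forall>n\<in>{1..Suc N}. Q n) \<longleftrightarrow> (\<forall>n\<le>N. Q (Suc n))" for Q
      by (auto simp: Ball_def) (metis Suc_le_D Suc_le_mono)
    then show ?thesis unfolding E_def avoid_event_def mem_Collect_eq
      by (auto simp: sum_case_nat add.assoc simp del: sum.lessThan_Suc)
  qed
  have E_meas: "E N \<in> sets (step_space p)" for N
  proof -
    have "(\<Inter>n\<in>{1..Suc N}. {\<xi>. x + (\<Sum>i<n. \<xi> i) \<notin> A}) \<in> sets (step_space p)"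
      by (intro sets.finite_INT position_event_measurable) auto
    also have "(\<Inter>n\<in>{1..Suc N}. {\<xi>. x + (\<Sum>i<n. \<xi> i) \<notin> A}) = E N"
      by (auto simp: E_def)
    finally show ?thesis .
  qed
  have mE: "measure (step_space p) (E N) = 1 - measure_pmf.expectation p (\<lambda>y. hit_prob p A N (x + y))" for N
  proof -
    have "emeasure (step_space p) (E N) = ennreal (measure_pmf.expectation p (\<lambda>y. 1 - hit_prob p A N (x + y)))"
      using hit_prob_bounds[of p A N] integrable_hit_prob[of p A N x]
      by (subst emeasure_step_space_first_step[OF E_meas])
        (simp add: eq emeasure_avoid_event nn_integral_eq_integral del: Bochner_Integration.integral_diff)
    then have "measure (step_space p) (E N) = measure_pmf.expectation p (\<lambda>y. 1 - hit_prob p A N (x + y))"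
      using hit_prob_bounds[of p A N]
      by (simp add: emeasure_eq_measure integral_nonneg_AE del: Bochner_Integration.integral_diff)
    then show ?thesis using integrable_hit_prob[of p A N x] by simp
  qed
  have "(\<lambda>N. measure (step_space p) (E N)) \<longlonglongrightarrow> measure (step_space p) (\<Inter>N. E N)"
    using E_meas by (intro finite_Lim_measure_decseq) (auto simp: decseq_def E_def)
  moreover have "measure (step_space p) (\<Inter>N. E N) = escape_prob p A x"
  proof -
    have "(\<Inter>N. E N) = {\<xi>. hitting_time A (\<lambda>n. x + (\<Sum>i<n. \<xi> i)) = \<infinity>}"
    proof -
      have "(\<forall>N. \<forall>n\<in>{1..Suc N}. Q n) \<longleftrightarrow> (\<forall>n>0. Q n)" for Q
      proof (intro iffI allI impI)
        fix n :: nat assume "\<forall>N. \<forall>n\<in>{1..Suc N}. Q n" "0 < n"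
        then show "Q n" by (auto dest: spec[of _ n])
      qed auto
      moreover have "(\<Inter>N. E N) = {\<xi>. \<forall>N. \<forall>n\<in>{1..Suc N}. x + (\<Sum>i<n. \<xi> i) \<notin> A}"
        unfolding E_def by (rule Collect_all_eq[symmetric])
      ultimately show ?thesis
        by (simp only: hitting_time_infinite_iff)
    qed
    then show ?thesis
      unfolding escape_prob_def space_walk_law using escape_event_measurable[of A p x]
      by (auto simp: walk_law_def step_space_def measure_distr[OF measurable_partial_sums] vimage_def space_PiM)
  qed
  ultimately show ?thesis by (simp add: mE)
qed

section \<open>The Dirichlet form of hitting probabilities\<close>

text \<open>Lattice sums live in \<open>ennreal\<close>, so interchanging them needs no summability
  argument; in the energy bound finiteness enters only where a term is cancelled.\<close>

abbreviation nn_sum :: "(int \<Rightarrow> ennreal) \<Rightarrow> ennreal" where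
  "nn_sum f \<equiv> integral\<^sup>N (count_space UNIV) f"

lemma nn_sum_shift: "(\<integral>\<^sup>+ x. f (x + c) \<partial>count_space UNIV) = nn_sum f" for c :: int
  by (rule nn_integral_bij_count_space) (auto intro!: bij_betwI[where g = "\<lambda>x. x - c"])

lemma nn_sum_swap: "(\<integral>\<^sup>+ x. \<integral>\<^sup>+ y. f x y \<partial>count_space UNIV \<partial>count_space UNIV) =
    (\<integral>\<^sup>+ y. \<integral>\<^sup>+ x. f x y \<partial>count_space UNIV \<partial>count_space UNIV)" for f :: "int \<Rightarrow> int \<Rightarrow> ennreal"
  using nn_integral_fst_count_space[of "\<lambda>(x, y). f x y"]
    nn_integral_snd_count_space[of "\<lambda>(x, y). f x y"] by simp

lemma nn_sum_pmf_shift: "(\<integral>\<^sup>+ y. ennreal (pmf p (y - x)) \<partial>count_space UNIV) = 1" for x :: int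
  using nn_sum_shift[of "\<lambda>z. ennreal (pmf p z)" "- x"] nn_integral_pmf[where p = p and A = UNIV] by simp

lemma nn_sum_pmf_reflect: "(\<integral>\<^sup>+ x. ennreal (pmf p (y - x)) \<partial>count_space UNIV) = 1" for y :: int
proof -
  have "(\<integral>\<^sup>+ x. ennreal (pmf p (y - x)) \<partial>count_space UNIV) = nn_sum (\<lambda>z. ennreal (pmf p z))"
    by (rule nn_integral_bij_count_space) (auto intro!: bij_betwI[where g = "\<lambda>x. y - x"])
  then show ?thesis using nn_integral_pmf[where p = p and A = UNIV] by simp
qed

lemma nn_sum_pmf_step:
  "(\<integral>\<^sup>+ y. ennreal (pmf p (y - x)) * f y \<partial>count_space UNIV) = (\<integral>\<^sup>+ y. f (x + y) \<partial>measure_pmf p)"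
  for x :: int
  using nn_sum_shift[of "\<lambda>z. ennreal (pmf p z) * f (x + z)" "- x"]
  by (simp add: nn_integral_measure_pmf)

text \<open>Counting measure is invariant under the walk, so each further time step adds at most
  \<open>card A\<close> to the sum. Without a time horizon hitting probabilities need not be
  summable, which is why \<open>N\<close> is kept finite until the end.\<close>

lemma nn_sum_hit_prob_finite:
  assumes "finite A"
  shows "nn_sum (\<lambda>x. ennreal (hit_prob p A N x)) < \<top>"
proof (induction N)
  case 0
  have "nn_sum (\<lambda>x. ennreal (indicator A x)) = emeasure (count_space UNIV) A"
    by (simp add: ennreal_indicator)
  then show ?case using assms by (simp add: emeasure_count_space of_nat_less_top)
next
  case (Suc N)
  let ?h = "\<lambda>x. ennreal (hit_prob p A N x)"
  have "nn_sum (\<lambda>x. ennreal (hit_prob p A (Suc N) x)) \<le>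
      nn_sum (\<lambda>x. indicator A x + (\<integral>\<^sup>+ y. ?h (x + y) \<partial>measure_pmf p))"
    using hit_prob_bounds[of p A N] integrable_hit_prob[of p A N]
    by (intro nn_integral_mono) (auto simp: nn_integral_eq_integral indicator_def)
  also have "\<dots> = emeasure (count_space UNIV) A + nn_sum (\<lambda>x. \<integral>\<^sup>+ y. ?h (x + y) \<partial>measure_pmf p)"
    by (subst nn_integral_add) auto
  also have "nn_sum (\<lambda>x. \<integral>\<^sup>+ y. ?h (x + y) \<partial>measure_pmf p) =
      (\<integral>\<^sup>+ x. \<integral>\<^sup>+ y. ennreal (pmf p (y - x)) * ?h y \<partial>count_space UNIV \<partial>count_space UNIV)"
    by (simp add: nn_sum_pmf_step)
  also have "\<dots> = nn_sum ?h"
    by (subst nn_sum_swap) (simp add: nn_integral_multc nn_sum_pmf_reflect)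
  finally show ?case
    using Suc assms by (auto simp: emeasure_count_space of_nat_less_top intro: order_le_less_trans)
qed

text \<open>The kernel \<open>pmf p (y - x)\<close> sums to 1 in each variable, so expanding the
  square turns the full energy into twice the sum of \<open>u x * (u x - Pu x)\<close>. Off
  \<open>A\<close> this summand is at most 0; on \<open>A\<close> it is \<open>1 - Pu x\<close>.
  Restricting to \<open>F\<close> only drops nonnegative terms.\<close>

lemma dirichlet_form_le_of_subharmonic_off:
  fixes p :: "int pmf" and u :: "int \<Rightarrow> real"
  defines "Pu \<equiv> \<lambda>x. measure_pmf.expectation p (\<lambda>y. u (x + y))"
  assumes bounds: "\<And>x. 0 \<le> u x" "\<And>x. u x \<le> 1"
    and fin: "nn_sum (\<lambda>x. ennreal (u x)) < \<top>"
    and A: "finite A" "\<And>a. a \<in> A \<Longrightarrow> u a = 1"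
    and sub: "\<And>x. x \<notin> A \<Longrightarrow> u x \<le> Pu x"
    and F: "finite F"
  shows "(\<Sum>x\<in>F. \<Sum>y\<in>F. pmf p (y - x) * (u x - u y)\<^sup>2) \<le> 2 * (\<Sum>a\<in>A. 1 - Pu a)"
proof -
  define U where "U x = ennreal (u x)" for x
  define q where "q x y = ennreal (pmf p (y - x))" for x y :: int
  define En where "En = (\<integral>\<^sup>+ x. \<integral>\<^sup>+ y. ennreal (pmf p (y - x) * (u x - u y)\<^sup>2) \<partial>count_space UNIV \<partial>count_space UNIV)"
  define B where "B = nn_sum (\<lambda>x. U x * ennreal (Pu x))"
  define S where "S = nn_sum (\<lambda>x. U x * U x)"
  have int: "integrable (measure_pmf p) (\<lambda>y. u (x + y))" for x
    using bounds by (auto intro!: measure_pmf.integrable_const_bound[where B = 1])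
  have Pu: "(\<integral>\<^sup>+ y. U (x + y) \<partial>measure_pmf p) = ennreal (Pu x)" for x
    unfolding U_def Pu_def using int bounds by (simp add: nn_integral_eq_integral)
  have Pu_le: "Pu x \<le> 1" for x
    unfolding Pu_def using int bounds by (intro measure_pmf.integral_le_const) auto
  have Pu_ge: "0 \<le> Pu x" for x
    unfolding Pu_def using bounds by (intro integral_nonneg_AE) auto
  \<comment> \<open>The cross term of the square is moved to the left, since subtraction in
    \<open>ennreal\<close> is truncated.\<close>
  have pw: "ennreal (pmf p (y - x) * (u x - u y)\<^sup>2) + 2 * (q x y * U x * U y) =
      q x y * (U x * U x) + q x y * (U y * U y)" for x y
  proof -
    have "ennreal (pmf p (y - x) * (u x - u y)\<^sup>2) + 2 * (q x y * U x * U y) =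
      ennreal (pmf p (y - x) * (u x - u y)\<^sup>2 + 2 * (pmf p (y - x) * u x * u y))"
      unfolding q_def U_def using bounds
      by (simp add: ennreal_mult)
    also have "\<dots> = ennreal (pmf p (y - x) * (u x * u x) + pmf p (y - x) * (u y * u y))"
      by (simp add: power2_eq_square algebra_simps)
    also have "\<dots> = q x y * (U x * U x) + q x y * (U y * U y)"
      unfolding q_def U_def using bounds
      by (simp add: ennreal_mult)
    finally show ?thesis .
  qed
  have B: "(\<integral>\<^sup>+ x. \<integral>\<^sup>+ y. q x y * U x * U y \<partial>count_space UNIV \<partial>count_space UNIV) = B"
    unfolding B_def
  proof (rule nn_integral_cong)
    fix x :: int
    have "(\<integral>\<^sup>+ y. q x y * U x * U y \<partial>count_space UNIV) = (\<integral>\<^sup>+ y. U x * (q x y * U y) \<partial>count_space UNIV)"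
      by (simp add: mult_ac)
    then show "(\<integral>\<^sup>+ y. q x y * U x * U y \<partial>count_space UNIV) = U x * ennreal (Pu x)"
      by (simp add: nn_integral_cmult q_def nn_sum_pmf_step Pu)
  qed
  have S1: "(\<integral>\<^sup>+ x. \<integral>\<^sup>+ y. q x y * (U x * U x) \<partial>count_space UNIV \<partial>count_space UNIV) = S"
    by (simp add: nn_integral_multc q_def nn_sum_pmf_shift S_def)
  have S2: "(\<integral>\<^sup>+ x. \<integral>\<^sup>+ y. q x y * (U y * U y) \<partial>count_space UNIV \<partial>count_space UNIV) = S"
    by (subst nn_sum_swap) (simp add: nn_integral_multc q_def nn_sum_pmf_reflect S_def)
  have "En + 2 * B = (\<integral>\<^sup>+ x. \<integral>\<^sup>+ y. ennreal (pmf p (y - x) * (u x - u y)\<^sup>2) +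
      2 * (q x y * U x * U y) \<partial>count_space UNIV \<partial>count_space UNIV)"
    unfolding En_def B[symmetric] by (simp add: nn_integral_add nn_integral_cmult)
  also have "\<dots> = S + S"
    unfolding pw by (simp add: nn_integral_add S1 S2)
  finally have identity: "En + 2 * B = S + S" .
  define D where "D = (\<Sum>a\<in>A. 1 - Pu a)"
  have D: "0 \<le> D" unfolding D_def using Pu_le by (intro sum_nonneg) auto
  have "S \<le> nn_sum (\<lambda>x. U x * ennreal (Pu x) + ennreal (1 - Pu x) * indicator A x)"
    unfolding S_def
  proof (rule nn_integral_mono)
    fix x :: int
    show "U x * U x \<le> U x * ennreal (Pu x) + ennreal (1 - Pu x) * indicator A x"
    proof (cases "x \<in> A")
      case True
      then show ?thesis using A Pu_le[of x] Pu_ge[of x]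
        by (simp add: U_def flip: ennreal_plus)
    next
      case False
      then show ?thesis using sub[of x] by (auto simp: U_def intro!: mult_left_mono ennreal_leI)
    qed
  qed
  also have "\<dots> = B + (\<Sum>a\<in>A. ennreal (1 - Pu a))"
    using A by (simp add: nn_integral_add B_def nn_integral_indicator_finite)
  also have "(\<Sum>a\<in>A. ennreal (1 - Pu a)) = ennreal D"
    unfolding D_def using Pu_le by (intro sum_ennreal) auto
  finally have SB: "S \<le> B + ennreal D" .
  \<comment> \<open>Finiteness of \<open>B\<close> is what later allows \<open>2 * B\<close> to be
    cancelled from both sides.\<close>
  have "B \<le> nn_sum U"
    unfolding B_def using Pu_le Pu_ge bounds
    by (intro nn_integral_mono) (auto simp: U_def ennreal_mult[symmetric] intro!: ennreal_leI mult_left_le)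
  with fin have B_fin: "B \<noteq> \<top>" unfolding U_def[abs_def] by (auto simp: top_unique)
  have "En + 2 * B \<le> (B + ennreal D) + (B + ennreal D)"
    unfolding identity by (intro add_mono SB)
  also have "\<dots> = ennreal (2 * D) + 2 * B"
    by (simp only: mult_2 ennreal_plus[OF D D] add_ac)
  finally have "2 * B + En \<le> 2 * B + ennreal (2 * D)"
    by (simp add: add.commute)
  then have "En \<le> ennreal (2 * D)"
    using B_fin by (simp add: ennreal_add_left_cancel_le ennreal_mult_eq_top_iff)
  moreover have "ennreal (\<Sum>x\<in>F. \<Sum>y\<in>F. pmf p (y - x) * (u x - u y)\<^sup>2) \<le> En"
  proof -
    have fs: "(\<Sum>x\<in>F. f x) \<le> nn_sum f" for f
    proof -
      have "(\<Sum>x\<in>F. f x) = nn_sum (\<lambda>x. f x * indicator F x)"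
        using F by (simp add: nn_integral_indicator_finite)
      also have "\<dots> \<le> nn_sum f" by (intro nn_integral_mono) (auto simp: indicator_def)
      finally show ?thesis .
    qed
    have "ennreal (\<Sum>x\<in>F. \<Sum>y\<in>F. pmf p (y - x) * (u x - u y)\<^sup>2) =
        (\<Sum>x\<in>F. \<Sum>y\<in>F. ennreal (pmf p (y - x) * (u x - u y)\<^sup>2))"
      by (simp add: sum_nonneg)
    also have "\<dots> \<le> En" unfolding En_def
      by (rule order_trans[OF sum_mono[OF fs] fs])
    finally show ?thesis .
  qed
  ultimately have "ennreal (\<Sum>x\<in>F. \<Sum>y\<in>F. pmf p (y - x) * (u x - u y)\<^sup>2) \<le> ennreal (2 * D)"
    by (rule order_trans[rotated])
  then show ?thesis using D by (simp add: D_def ennreal_le_iff)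
qed

section \<open>Triadic blocks of the Cantor set\<close>

lemma cantor_set_0: "cantor_set 0 = {0}"
  by (auto simp: cantor_set_def)

lemma finite_cantor_set [simp]: "finite (cantor_set n)"
  by (rule finite_subset[of _ "{0..3 ^ n - 1}"]) (auto simp: cantor_set_def)

text \<open>The lowest ternary digit is split off: the condition at \<open>j = 0\<close> concerns
  \<open>i mod 3\<close>, and the one at \<open>Suc j\<close> is condition \<open>j\<close> for
  \<open>i div 3\<close>.\<close>

lemma cantor_set_Suc_iff:
  "i \<in> cantor_set (Suc n) \<longleftrightarrow> i div 3 \<in> cantor_set n \<and> i mod 3 \<noteq> 1"
proof -
  have "(\<forall>j\<in>{0..<Suc n}. Q j) \<longleftrightarrow> Q 0 \<and> (\<forall>j\<in>{0..<n}. Q (Suc j))" for Q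
    by (auto simp: less_Suc_eq_0_disj)
  note split = this[of "\<lambda>j. \<not> [i div 3 ^ j = 1] (mod 3)"]
  have range: "i \<in> {0..3 ^ Suc n - 1} \<longleftrightarrow> i div 3 \<in> {0..3 ^ n - 1}"
    by auto
  have shift: "i div 3 ^ Suc j = i div 3 div 3 ^ j" for j
    by (simp add: zdiv_zmult2_eq)
  show ?thesis
    unfolding cantor_set_def mem_Collect_eq split range shift by (auto simp: cong_def)
qed

lemma cantor_set_Suc: "cantor_set (Suc n) = (\<lambda>i. 3 * i) ` cantor_set n \<union> (\<lambda>i. 3 * i + 2) ` cantor_set n"
proof (intro set_eqI iffI)
  fix i assume "i \<in> cantor_set (Suc n)"
  then have d: "i div 3 \<in> cantor_set n" and m: "i mod 3 \<noteq> 1"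
    by (auto simp: cantor_set_Suc_iff)
  have "i = 3 * (i div 3) \<or> i = 3 * (i div 3) + 2"
    using m by presburger
  then show "i \<in> (\<lambda>i. 3 * i) ` cantor_set n \<union> (\<lambda>i. 3 * i + 2) ` cantor_set n"
    using d by blast
next
  fix i assume "i \<in> (\<lambda>i. 3 * i) ` cantor_set n \<union> (\<lambda>i. 3 * i + 2) ` cantor_set n"
  then show "i \<in> cantor_set (Suc n)"
    by (auto simp: cantor_set_Suc_iff)
qed

lemma card_cantor_set: "card (cantor_set n) = 2 ^ n"
proof (induction n)
  case (Suc n)
  have "(\<lambda>i. 3 * i) ` cantor_set n \<inter> (\<lambda>i. 3 * i + 2) ` cantor_set n = {}"
    by (auto, presburger)
  then show ?case
    unfolding cantor_set_Suc using Suc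
    by (subst card_Un_disjoint) (auto simp: card_image inj_on_def)
qed (simp add: cantor_set_0)

text \<open>The block prescribes all but the \<open>k\<close> lowest ternary digits, and each of
  these is 0 or 2. Stripping the lowest digit lowers \<open>n\<close> together with
  \<open>k\<close>, hence the induction over arbitrary \<open>n\<close>.\<close>

lemma card_cantor_set_block_le: "card {a \<in> cantor_set n. a div 3 ^ k = q} \<le> 2 ^ k"
proof (induction k arbitrary: n q)
  case 0
  have "card {a \<in> cantor_set n. a = q} \<le> card {q}"
    by (intro card_mono) auto
  then show ?case by simp
next
  case (Suc k)
  show ?case
  proof (cases n)
    case 0
    have "card {a \<in> cantor_set n. a div 3 ^ Suc k = q} \<le> card (cantor_set n)"
      by (intro card_mono) auto
    also have "\<dots> \<le> 2 ^ Suc k"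
      by (simp add: 0 cantor_set_0)
    finally show ?thesis .
  next
    case (Suc m)
    let ?B = "{b \<in> cantor_set m. b div 3 ^ k = q}"
    have "{a \<in> cantor_set n. a div 3 ^ Suc k = q} \<subseteq> (\<lambda>i. 3 * i) ` ?B \<union> (\<lambda>i. 3 * i + 2) ` ?B"
      by (auto simp: Suc cantor_set_Suc zdiv_zmult2_eq)
    then have "card {a \<in> cantor_set n. a div 3 ^ Suc k = q} \<le> card ((\<lambda>i. 3 * i) ` ?B \<union> (\<lambda>i. 3 * i + 2) ` ?B)"
      by (intro card_mono) auto
    also have "\<dots> \<le> card ?B + card ?B"
      by (intro order_trans[OF card_Un_le] add_mono card_image_le) auto
    also have "\<dots> \<le> 2 ^ Suc k"
      using Suc.IH[of m q] by simp
    finally show ?thesis .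
  qed
qed

lemma card_cantor_set_block_le_min: "card {a \<in> cantor_set n. a div 3 ^ k = q} \<le> 2 ^ min k n"
proof (cases "k \<le> n")
  case True
  then show ?thesis using card_cantor_set_block_le[of n k q] by (simp add: min_def)
next
  case False
  have "card {a \<in> cantor_set n. a div 3 ^ k = q} \<le> card (cantor_set n)"
    by (intro card_mono) auto
  then show ?thesis using False by (simp add: card_cantor_set min_def)
qed

section \<open>Means over triadic blocks\<close>

definition block :: "nat \<Rightarrow> int \<Rightarrow> int set" where
  "block k a = {x. x div 3 ^ k = a div 3 ^ k}"

definition block_mean :: "(int \<Rightarrow> real) \<Rightarrow> nat \<Rightarrow> int \<Rightarrow> real" where
  "block_mean u k a = (\<Sum>x\<in>block k a. u x) / 3 ^ k"

lemma block_eq: "block k a = {a div 3 ^ k * 3 ^ k ..< a div 3 ^ k * 3 ^ k + 3 ^ k}"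
proof -
  have "x div 3 ^ k = q \<longleftrightarrow> q * 3 ^ k \<le> x \<and> x < q * 3 ^ k + 3 ^ k" for x q :: int
  proof
    assume "x div 3 ^ k = q"
    then have "x = q * 3 ^ k + x mod 3 ^ k" by (metis div_mult_mod_eq)
    moreover have "0 \<le> x mod 3 ^ k" "x mod 3 ^ k < 3 ^ k" by simp_all
    ultimately show "q * 3 ^ k \<le> x \<and> x < q * 3 ^ k + 3 ^ k" by linarith
  next
    assume *: "q * 3 ^ k \<le> x \<and> x < q * 3 ^ k + 3 ^ k"
    have "x div 3 ^ k = ((x - q * 3 ^ k) + q * 3 ^ k) div 3 ^ k" by simp
    also have "\<dots> = q + (x - q * 3 ^ k) div 3 ^ k"
      by (rule div_mult_self1) simp
    also have "(x - q * 3 ^ k) div 3 ^ k = 0" using * by (intro div_pos_pos_trivial) auto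
    finally show "x div 3 ^ k = q" by simp
  qed
  then show ?thesis by (auto simp: block_def)
qed

lemma finite_block [simp]: "finite (block k a)"
  by (simp add: block_eq)

lemma card_block: "card (block k a) = 3 ^ k"
  by (simp add: block_eq nat_power_eq)

lemma block_mean_0: "block_mean u 0 a = u a"
proof -
  have "block 0 a = {a}" by (auto simp: block_def)
  then show ?thesis by (simp add: block_mean_def)
qed

lemma block_mono: "block k a \<subseteq> block (Suc k) a"
  by (auto simp: block_def zdiv_zmult2_eq mult.commute[of 3])

lemma block_subset_root:
  assumes "a \<in> {0..<3 ^ K}" "k \<le> K"
  shows "block k a \<subseteq> {0..<3 ^ K}"
proof
  fix x assume "x \<in> block k a"
  then have "x div 3 ^ k div 3 ^ (K - k) = a div 3 ^ k div 3 ^ (K - k)"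
    by (simp add: block_def)
  then have "x div 3 ^ K = a div 3 ^ K"
    using assms by (simp add: zdiv_zmult2_eq[symmetric] power_add[symmetric])
  also have "a div 3 ^ K = 0" using assms by simp
  finally show "x \<in> {0..<3 ^ K}"
    using div_mult_mod_eq[of x "3 ^ K"] pos_mod_bound[of "3 ^ K" x] pos_mod_sign[of "3 ^ K" x]
    by simp
qed

text \<open>The difference of the two means is the mean of \<open>u x - u y\<close> over the product
  of the blocks, and the square of a mean is at most the mean of the squares.\<close>

lemma block_mean_diff_square_le:
  "(block_mean u k a - block_mean u (Suc k) a)\<^sup>2 \<le>
     (\<Sum>x\<in>block k a. \<Sum>y\<in>block (Suc k) a. (u x - u y)\<^sup>2) / (3 ^ k * 3 ^ Suc k)"
proof -
  let ?B = "block k a" and ?B' = "block (Suc k) a"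
  have "(\<Sum>(x, y)\<in>?B \<times> ?B'. u x - u y) = (\<Sum>x\<in>?B. \<Sum>y\<in>?B'. u x - u y)"
    by (simp add: sum.cartesian_product)
  also have "\<dots> = 3 ^ Suc k * (\<Sum>x\<in>?B. u x) - 3 ^ k * (\<Sum>y\<in>?B'. u y)"
    by (simp add: sum_subtractf card_block sum_distrib_left del: power_Suc)
  also have "\<dots> = (block_mean u k a - block_mean u (Suc k) a) * (3 ^ k * 3 ^ Suc k)"
    by (simp add: block_mean_def field_simps)
  finally have "block_mean u k a - block_mean u (Suc k) a =
      (\<Sum>(x, y)\<in>?B \<times> ?B'. u x - u y) / (3 ^ k * 3 ^ Suc k)"
    by (simp add: field_simps)
  moreover have "(\<Sum>(x, y)\<in>?B \<times> ?B'. u x - u y)\<^sup>2 \<le>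
      (\<Sum>(x, y)\<in>?B \<times> ?B'. (u x - u y)\<^sup>2) * (3 ^ k * 3 ^ Suc k)"
    using Cauchy_Schwarz_ineq_sum[of "\<lambda>(x, y). u x - u y" "\<lambda>_. 1" "?B \<times> ?B'"]
    by (simp add: case_prod_unfold card_cartesian_product card_block)
  moreover have "(S / m)\<^sup>2 \<le> T / m" if "S\<^sup>2 \<le> T * m" "0 < m" for S T m :: real
    using that by (simp add: power_divide field_simps power2_eq_square)
  ultimately show ?thesis
    by (simp add: sum.cartesian_product)
qed

section \<open>Comparison of the hierarchical kernel with the step law\<close>

lemma geometric_tail_le:
  fixes t :: real
  assumes "0 \<le> t" "t < 1"
  shows "(\<Sum>k\<in>{m..<K}. t ^ k) \<le> t ^ m / (1 - t)"
proof (cases "m \<le> K")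
  case True
  then have "(\<Sum>k\<in>{m..<K}. t ^ k) * (1 - t) = t ^ m - t ^ K"
    by (induction rule: dec_induct) (simp_all add: distrib_right, simp add: algebra_simps)
  also have "\<dots> \<le> t ^ m" using assms by simp
  finally show ?thesis using assms by (simp add: field_simps)
qed (use assms in auto)

text \<open>The weight is chosen so that the level \<open>k\<close> term is \<open>t ^ k / 3\<close>
  with \<open>t = 3 powr (- 1 - \<alpha>)\<close>. It occurs only if both points share a block of
  side \<open>3 ^ Suc k\<close>, so the sum starts at the scale of their distance and is dominated
  by its first term.\<close>

lemma weighted_triadic_kernel_sum_le:
  fixes x y :: int and \<alpha> :: real
  assumes \<alpha>: "0 < \<alpha>" "\<alpha> < 1" and "x \<noteq> y"
  shows "(\<Sum>k<K. if x div 3 ^ Suc k = y div 3 ^ Suc k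
        then 1 / ((3 powr (\<alpha> - 1)) ^ k * (3 ^ k * 3 ^ Suc k)) else 0) \<le>
      9 * \<bar>real_of_int (y - x)\<bar> powr (- 1 - \<alpha>)"
proof -
  define t :: real where "t = 3 powr (- 1 - \<alpha>)"
  define d where "d = \<bar>y - x\<bar>"
  have d: "1 \<le> d" using assms by (simp add: d_def)
  have "t \<le> 3 powr (- 1)" unfolding t_def using \<alpha> by (intro powr_mono) auto
  also have "3 powr (- 1) = (1 / 3 :: real)" by (simp add: powr_minus)
  finally have t: "0 < t" "t \<le> 1 / 3" by (simp_all add: t_def)
  have "3 powr (\<alpha> - 1) * 3 powr 2 * t = 3 powr (\<alpha> - 1 + 2 + (- 1 - \<alpha>))"
    unfolding t_def powr_add ..
  then have "3 powr (\<alpha> - 1) * (3 * 3) * t = 1" by simp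
  then have "(3 powr (\<alpha> - 1)) ^ k * (3 ^ k * 3 ^ k) * t ^ k = 1" for k
    by (simp only: power_mult_distrib[symmetric] power_one)
  then have tk: "1 / ((3 powr (\<alpha> - 1)) ^ k * (3 ^ k * 3 ^ Suc k)) = t ^ k / 3" for k
    by (simp add: field_simps)
  have close: "d < 3 ^ Suc k" if "x div 3 ^ Suc k = y div 3 ^ Suc k" for k
  proof -
    have "y \<in> block (Suc k) x" "x \<in> block (Suc k) x" using that by (auto simp: block_def)
    then show ?thesis unfolding block_eq d_def by auto
  qed
  have ex: "\<exists>k. d < 3 ^ Suc k"
  proof -
    obtain k where "real_of_int d < 3 ^ k" using real_arch_pow[of 3 "real_of_int d"] by auto
    then have "d < 3 ^ k" by (metis of_int_less_iff of_int_numeral of_int_power)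
    also have "(3::int) ^ k \<le> 3 ^ Suc k" by simp
    finally show ?thesis by blast
  qed
  \<comment> \<open>The smallest level at which a block of side \<open>3 ^ Suc k\<close> is long
    enough for both points; lower levels contribute nothing.\<close>
  define k0 where "k0 = (LEAST k. d < 3 ^ Suc k)"
  have k0: "d < 3 ^ Suc k0" unfolding k0_def using ex by (rule LeastI_ex)
  have "(\<Sum>k<K. if x div 3 ^ Suc k = y div 3 ^ Suc k
        then 1 / ((3 powr (\<alpha> - 1)) ^ k * (3 ^ k * 3 ^ Suc k)) else 0) =
      (\<Sum>k\<in>{k\<in>{..<K}. x div 3 ^ Suc k = y div 3 ^ Suc k}. t ^ k / 3)"
    unfolding tk by (rule sum.inter_filter[symmetric]) simp
  also have "\<dots> \<le> (\<Sum>k\<in>{k0..<K}. t ^ k / 3)"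
    using t close by (intro sum_mono2) (auto simp: k0_def intro!: Least_le)
  also have "\<dots> = (\<Sum>k\<in>{k0..<K}. t ^ k) / 3" by (simp add: sum_divide_distrib)
  also have "\<dots> \<le> (t ^ k0 / (1 - t)) / 3"
    using t by (intro divide_right_mono geometric_tail_le) auto
  \<comment> \<open>By \<open>t \<le> 1 / 3\<close>, the factor \<open>1 / (3 * (1 - t))\<close> is
    at most \<open>1 / 2\<close>.\<close>
  also have "\<dots> \<le> t ^ k0"
    using t by (simp add: field_simps)
  also have "t ^ k0 = (3 ^ k0) powr (- 1 - \<alpha>)"
    unfolding t_def by (simp add: powr_power powr_realpow[symmetric] powr_powr mult.commute)
  also have "\<dots> \<le> (real_of_int d / 3) powr (- 1 - \<alpha>)"
  proof (rule powr_mono2')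
    show "real_of_int d / 3 \<le> 3 ^ k0"
      using k0 by (metis less_imp_le mult.commute of_int_less_iff of_int_numeral of_int_power
          pos_divide_le_eq power_Suc zero_less_numeral)
  qed (use \<alpha> d in auto)
  also have "\<dots> = real_of_int d powr (- 1 - \<alpha>) * 3 powr (1 + \<alpha>)"
    using d by (simp add: powr_divide powr_minus powr_diff powr_add field_simps)
  \<comment> \<open>The loss \<open>3 powr (1 + \<alpha>)\<close>, due to \<open>3 ^ k0\<close>
    being only at least \<open>d / 3\<close>, is rounded up to the constant 9.\<close>
  also have "\<dots> \<le> real_of_int d powr (- 1 - \<alpha>) * 3 powr 2"
    using \<alpha> by (intro mult_left_mono powr_mono) auto
  finally show ?thesis by (simp add: d_def mult.commute)
qed

lemma cantor_set_subset: "cantor_set n \<subseteq> {0..<3 ^ n}"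
  by (auto simp: cantor_set_def)

text \<open>At level \<open>k\<close> a pair of points is charged by at most
  \<open>2 ^ min k n\<close> Cantor points. Putting this count into the Cauchy--Schwarz weight
  removes it from the energy, and the kernel that remains does not depend on
  \<open>n\<close>.\<close>

lemma cantor_set_block_energy_lower_bound:
  fixes u :: "int \<Rightarrow> real" and \<rho> :: real
  assumes one: "\<And>a. a \<in> cantor_set n \<Longrightarrow> u a = 1" and "n \<le> K" and \<rho>: "0 < \<rho>"
  shows "2 ^ n * (1 - block_mean u K 0)\<^sup>2 \<le>
    (\<Sum>k<K. 2 ^ min k n * \<rho> ^ k) *
    (\<Sum>x\<in>{0..<3 ^ K}. \<Sum>y\<in>{0..<3 ^ K}. (u x - u y)\<^sup>2 *
      (\<Sum>k<K. if x div 3 ^ Suc k = y div 3 ^ Suc k then 1 / (\<rho> ^ k * (3 ^ k * 3 ^ Suc k)) else 0))"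
proof -
  let ?A = "cantor_set n" and ?F = "{0..<3 ^ K} :: int set"
  define M where "M = block_mean u K 0"
  define d where "d k a = block_mean u k a - block_mean u (Suc k) a" for k a
  define m :: "nat \<Rightarrow> real" where "m k = 3 ^ k * 3 ^ Suc k" for k
  define s :: "nat \<Rightarrow> real" where "s k = 2 ^ min k n * \<rho> ^ k" for k
  define Q where "Q x y = (u x - u y)\<^sup>2" for x y
  have m: "0 < m k" for k by (simp add: m_def)
  have s: "0 < s k" for k using \<rho> by (simp add: s_def)
  have "(3::int) ^ n \<le> 3 ^ K" using \<open>n \<le> K\<close> by (intro power_increasing) auto
  then have "{0..<3 ^ n} \<subseteq> ?F" by (intro ivl_subset[THEN iffD2]) simp
  with cantor_set_subset have AF: "?A \<subseteq> ?F" by (rule order_trans)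
  \<comment> \<open>The level 0 mean is \<open>u a = 1\<close>, and at level \<open>K\<close> every
    Cantor point lies in the block of 0.\<close>
  have telescope: "(\<Sum>k<K. d k a) = 1 - M" if "a \<in> ?A" for a
  proof -
    have "block K a = block K 0" using that AF by (auto simp: block_def subset_iff)
    then have "block_mean u K a = M" by (simp add: M_def block_mean_def)
    then show ?thesis unfolding d_def using one[OF that]
      by (subst sum_lessThan_telescope') (simp add: block_mean_0)
  qed
  have level: "(\<Sum>a\<in>?A. (d k a)\<^sup>2) \<le>
      (\<Sum>x\<in>?F. \<Sum>y\<in>?F. if x div 3 ^ Suc k = y div 3 ^ Suc k then Q x y * 2 ^ min k n / m k else 0)"
    if k: "k < K" for k
  proof -
    have "(d k a)\<^sup>2 \<le> (\<Sum>x\<in>block k a. \<Sum>y\<in>block (Suc k) a. Q x y / m k)" for a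
      using block_mean_diff_square_le[of u k a]
      unfolding d_def Q_def m_def sum_divide_distrib .
    then have "(\<Sum>a\<in>?A. (d k a)\<^sup>2) \<le> (\<Sum>a\<in>?A. (\<Sum>x\<in>block k a. \<Sum>y\<in>block (Suc k) a. Q x y / m k))"
      by (rule sum_mono)
    \<comment> \<open>Both block sums are extended by zero to the root block \<open>?F\<close>,
      which does not depend on \<open>a\<close>, so that the sum over \<open>a\<close> can move
      inside.\<close>
    also have "\<dots> = (\<Sum>a\<in>?A. \<Sum>x\<in>?F. \<Sum>y\<in>?F.
        if x \<in> block k a \<and> y \<in> block (Suc k) a then Q x y / m k else 0)"
    proof (rule sum.cong[OF refl])
      fix a assume "a \<in> ?A"
      then have "a \<in> ?F" using AF by blast
      then have sub: "block k a \<subseteq> ?F" "block (Suc k) a \<subseteq> ?F"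
        using k by (intro block_subset_root; simp)+
      have restrict: "sum f B = (\<Sum>x\<in>?F. if x \<in> B then f x else 0)" if "B \<subseteq> ?F" for f :: "int \<Rightarrow> real" and B
        using sum.inter_restrict[of ?F f B] that by (simp add: Int_absorb1)
      have "(\<Sum>x\<in>block k a. \<Sum>y\<in>block (Suc k) a. Q x y / m k) =
          (\<Sum>x\<in>?F. if x \<in> block k a then (\<Sum>y\<in>?F. if y \<in> block (Suc k) a then Q x y / m k else 0) else 0)"
        unfolding restrict[OF sub(1)] restrict[OF sub(2)] ..
      also have "\<dots> = (\<Sum>x\<in>?F. \<Sum>y\<in>?F.
          if x \<in> block k a \<and> y \<in> block (Suc k) a then Q x y / m k else 0)"
        by (intro sum.cong) auto
      finally show "(\<Sum>x\<in>block k a. \<Sum>y\<in>block (Suc k) a. Q x y / m k) = \<dots>" .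
    qed
    also have "\<dots> = (\<Sum>x\<in>?F. \<Sum>y\<in>?F. \<Sum>a\<in>?A.
        if x \<in> block k a \<and> y \<in> block (Suc k) a then Q x y / m k else 0)"
      by (subst sum.swap, rule sum.cong[OF refl], rule sum.swap)
    also have "\<dots> \<le> (\<Sum>x\<in>?F. \<Sum>y\<in>?F.
        if x div 3 ^ Suc k = y div 3 ^ Suc k then Q x y * 2 ^ min k n / m k else 0)"
    proof (intro sum_mono)
      fix x y :: int
      show "(\<Sum>a\<in>?A. if x \<in> block k a \<and> y \<in> block (Suc k) a then Q x y / m k else 0) \<le>
          (if x div 3 ^ Suc k = y div 3 ^ Suc k then Q x y * 2 ^ min k n / m k else 0)"
      proof (cases "x div 3 ^ Suc k = y div 3 ^ Suc k")
        case True
        \<comment> \<open>Only the condition on \<open>x\<close> is kept: the Cantor points charging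
          the pair lie in the block of side \<open>3 ^ k\<close> that contains
          \<open>x\<close>.\<close>
        have "(\<Sum>a\<in>?A. if x \<in> block k a \<and> y \<in> block (Suc k) a then Q x y / m k else 0) \<le>
            (\<Sum>a\<in>?A. if a div 3 ^ k = x div 3 ^ k then Q x y / m k else 0)"
          using m[of k] by (intro sum_mono) (auto simp: block_def Q_def)
        also have "\<dots> = real (card {a \<in> ?A. a div 3 ^ k = x div 3 ^ k}) * (Q x y / m k)"
          by (simp add: sum.inter_filter[symmetric])
        also have "\<dots> \<le> 2 ^ min k n * (Q x y / m k)"
        proof (rule mult_right_mono)
          show "real (card {a \<in> ?A. a div 3 ^ k = x div 3 ^ k}) \<le> 2 ^ min k n"
            using of_nat_mono[OF card_cantor_set_block_le_min, where 'a = real] by simp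
        qed (use m[of k] in \<open>simp add: Q_def\<close>)
        finally show ?thesis using True by (simp add: mult.commute)
      next
        case False
        have "\<not> (x \<in> block k a \<and> y \<in> block (Suc k) a)" for a
        proof
          assume "x \<in> block k a \<and> y \<in> block (Suc k) a"
          then have "x \<in> block (Suc k) a" "y \<in> block (Suc k) a"
            using block_mono by auto
          with False show False unfolding block_def mem_Collect_eq by simp
        qed
        with False show ?thesis by (simp only: if_False sum.neutral_const)
      qed
    qed
    finally show ?thesis .
  qed
  have "(\<Sum>a\<in>?A. \<Sum>k<K. (d k a)\<^sup>2 / s k) = (\<Sum>k<K. (\<Sum>a\<in>?A. (d k a)\<^sup>2) / s k)"
    by (subst sum.swap) (simp add: sum_divide_distrib)
  also have "\<dots> \<le> (\<Sum>k<K. (\<Sum>x\<in>?F. \<Sum>y\<in>?F.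
      if x div 3 ^ Suc k = y div 3 ^ Suc k then Q x y * 2 ^ min k n / m k else 0) / s k)"
    using s by (intro sum_mono divide_right_mono level) (auto intro: less_imp_le)
  \<comment> \<open>The factor \<open>2 ^ min k n\<close> cancels against the one in
    \<open>s k\<close>.\<close>
  also have "\<dots> = (\<Sum>k<K. \<Sum>x\<in>?F. \<Sum>y\<in>?F. Q x y *
      (if x div 3 ^ Suc k = y div 3 ^ Suc k then 1 / (\<rho> ^ k * (3 ^ k * 3 ^ Suc k)) else 0))"
    using \<rho> unfolding sum_divide_distrib by (intro sum.cong) (auto simp: s_def m_def field_simps)
  also have "\<dots> = (\<Sum>x\<in>?F. \<Sum>y\<in>?F. Q x y *
      (\<Sum>k<K. if x div 3 ^ Suc k = y div 3 ^ Suc k then 1 / (\<rho> ^ k * (3 ^ k * 3 ^ Suc k)) else 0))"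
    unfolding sum_distrib_left by (subst sum.swap, rule sum.cong[OF refl], rule sum.swap)
  finally have energy: "(\<Sum>a\<in>?A. \<Sum>k<K. (d k a)\<^sup>2 / s k) \<le> \<dots>" .
  \<comment> \<open>Cauchy--Schwarz over pairs of a Cantor point and a level. The number of points
    gives a factor \<open>2 ^ n\<close> on the right, which cancels one of the two on the
    left.\<close>
  have "(2 ^ n * (1 - M))\<^sup>2 = (\<Sum>a\<in>?A. \<Sum>k<K. d k a)\<^sup>2"
    by (simp add: telescope card_cantor_set)
  also have "\<dots> = (\<Sum>(a, k)\<in>?A \<times> {..<K}. sqrt (s k) * (d k a / sqrt (s k)))\<^sup>2"
    using s by (simp add: sum.cartesian_product less_imp_neq[symmetric])
  also have "\<dots> \<le> (\<Sum>(a, k)\<in>?A \<times> {..<K}. (sqrt (s k))\<^sup>2) * (\<Sum>(a, k)\<in>?A \<times> {..<K}. (d k a / sqrt (s k))\<^sup>2)"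
    using Cauchy_Schwarz_ineq_sum[of "\<lambda>(a, k). sqrt (s k)" "\<lambda>(a, k). d k a / sqrt (s k)" "?A \<times> {..<K}"]
    by (simp add: case_prod_unfold)
  also have "\<dots> = (2 ^ n * (\<Sum>k<K. s k)) * (\<Sum>a\<in>?A. \<Sum>k<K. (d k a)\<^sup>2 / s k)"
    using s by (simp add: sum.cartesian_product[symmetric] power_divide less_imp_le card_cantor_set)
  also have "\<dots> \<le> (2 ^ n * (\<Sum>k<K. s k)) * (\<Sum>x\<in>?F. \<Sum>y\<in>?F. Q x y *
      (\<Sum>k<K. if x div 3 ^ Suc k = y div 3 ^ Suc k then 1 / (\<rho> ^ k * (3 ^ k * 3 ^ Suc k)) else 0))"
    using s by (intro mult_left_mono energy mult_nonneg_nonneg sum_nonneg) (auto intro: less_imp_le)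
  finally have "2 ^ n * (2 ^ n * (1 - M)\<^sup>2) \<le> 2 ^ n * ((\<Sum>k<K. s k) * (\<Sum>x\<in>?F. \<Sum>y\<in>?F. Q x y *
      (\<Sum>k<K. if x div 3 ^ Suc k = y div 3 ^ Suc k then 1 / (\<rho> ^ k * (3 ^ k * 3 ^ Suc k)) else 0)))"
    by (simp add: power2_eq_square mult_ac)
  then show ?thesis
    unfolding M_def s_def Q_def by (simp del: power_Suc)
qed

text \<open>Below \<open>n\<close> the terms are \<open>(2 * \<rho>) ^ k\<close>. From
  \<open>n\<close> on the power of 2 stops growing, and the geometric tail is absorbed as the term
  \<open>k = n\<close>, so the bound is free of \<open>K\<close>.\<close>

lemma sum_two_power_min_le:
  fixes \<rho> :: real
  assumes \<rho>: "0 < \<rho>" "\<rho> < 1" and "n \<le> K"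
  shows "(\<Sum>k<K. 2 ^ min k n * \<rho> ^ k) \<le> (\<Sum>k\<le>n. (2 * \<rho>) ^ k) / (1 - \<rho>)"
proof -
  have "{..<K} = {..<n} \<union> {n..<K}" using \<open>n \<le> K\<close> by auto
  then have "(\<Sum>k<K. 2 ^ min k n * \<rho> ^ k) =
      (\<Sum>k<n. 2 ^ min k n * \<rho> ^ k) + (\<Sum>k\<in>{n..<K}. 2 ^ min k n * \<rho> ^ k)"
    by (simp add: sum.union_disjoint ivl_disj_int)
  also have "(\<Sum>k\<in>{n..<K}. 2 ^ min k n * \<rho> ^ k) = 2 ^ n * (\<Sum>k\<in>{n..<K}. \<rho> ^ k)"
    unfolding sum_distrib_left by (intro sum.cong) (auto simp: min_def)
  also have "\<dots> \<le> 2 ^ n * (\<rho> ^ n / (1 - \<rho>))"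
    using \<rho> by (intro mult_left_mono geometric_tail_le) auto
  also have "(\<Sum>k<n. 2 ^ min k n * \<rho> ^ k) = (\<Sum>k<n. (2 * \<rho>) ^ k)"
    by (intro sum.cong) (auto simp: power_mult_distrib)
  also have "\<dots> \<le> (\<Sum>k<n. (2 * \<rho>) ^ k) / (1 - \<rho>)"
    using \<rho> by (simp add: le_divide_eq mult_left_le sum_nonneg)
  finally show ?thesis
    by (simp add: power_mult_distrib add_divide_distrib flip: lessThan_Suc_atMost)
qed

section \<open>The capacity bound\<close>

text \<open>Block sums stay below the total sum while the block size grows. This removes the root
  mean from the energy bound as \<open>K\<close> tends to infinity.\<close>

lemma block_mean_tendsto_0:
  fixes u :: "int \<Rightarrow> real"
  assumes "\<And>x. 0 \<le> u x" and fin: "nn_sum (\<lambda>x. ennreal (u x)) < \<top>"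
  shows "(\<lambda>K. block_mean u K a) \<longlonglongrightarrow> 0"
proof -
  obtain V where V: "nn_sum (\<lambda>x. ennreal (u x)) = ennreal V" "0 \<le> V"
    using fin by (cases "nn_sum (\<lambda>x. ennreal (u x))") auto
  have le: "(\<Sum>x\<in>block K a. u x) \<le> V" for K
  proof -
    have "ennreal (\<Sum>x\<in>block K a. u x) = nn_sum (\<lambda>x. ennreal (u x) * indicator (block K a) x)"
      using assms(1) by (simp add: nn_integral_indicator_finite)
    also have "\<dots> \<le> ennreal V"
      unfolding V(1)[symmetric] by (intro nn_integral_mono) (auto simp: indicator_def)
    finally show ?thesis using V(2) by simp
  qed
  have "(\<lambda>K. V * (1 / 3) ^ K) \<longlonglongrightarrow> V * 0"
    by (intro tendsto_mult_left LIMSEQ_power_zero) auto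
  then have lim: "(\<lambda>K. V / 3 ^ K) \<longlonglongrightarrow> 0"
    by (simp add: power_divide)
  show ?thesis
  proof (rule tendsto_sandwich[OF _ _ tendsto_const lim])
    show "\<forall>\<^sub>F K in sequentially. 0 \<le> block_mean u K a"
      using assms(1) by (simp add: block_mean_def sum_nonneg)
    show "\<forall>\<^sub>F K in sequentially. block_mean u K a \<le> V / 3 ^ K"
      using le by (simp add: block_mean_def divide_right_mono)
  qed
qed

text \<open>The order of limits matters: first \<open>K\<close> grows at fixed \<open>N\<close>,
  where summability makes the root mean vanish; then \<open>N\<close> grows, and the summed
  no-return probabilities become the capacity.\<close>

lemma walk_capacity_cantor_set_lower_bound:
  assumes "alpha_walk \<alpha> p"
  obtains C where "0 < C"
    "\<And>n. 2 ^ n \<le> C * (\<Sum>k\<le>n. (2 * 3 powr (\<alpha> - 1)) ^ k) * walk_capacity p (cantor_set n)"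
proof -
  from assms obtain c\<^sub>0 where \<alpha>: "0 < \<alpha>" "\<alpha> < 1" and c0: "0 < c\<^sub>0"
    and p_ge: "\<And>x. x \<noteq> 0 \<Longrightarrow> c\<^sub>0 * \<bar>real_of_int x\<bar> powr (- 1 - \<alpha>) \<le> pmf p x"
    unfolding alpha_walk_def by blast
  define \<rho> :: real where "\<rho> = 3 powr (\<alpha> - 1)"
  have "\<rho> < 3 powr 0" unfolding \<rho>_def using \<alpha> by (intro powr_less_mono) auto
  then have \<rho>: "0 < \<rho>" "\<rho> < 1" by (simp_all add: \<rho>_def)
  \<comment> \<open>Here 18 is 9 from the kernel comparison times 2 from the Dirichlet form bound,
    and \<open>1 / (1 - \<rho>)\<close> comes from the sum of the weights.\<close>
  define C where "C = 18 / (c\<^sub>0 * (1 - \<rho>))"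
  have C: "0 < C" using c0 \<rho> by (simp add: C_def)
  have "2 ^ n \<le> C * (\<Sum>k\<le>n. (2 * \<rho>) ^ k) * walk_capacity p (cantor_set n)" for n
  proof -
    let ?A = "cantor_set n"
    define R where "R = (\<Sum>k\<le>n. (2 * \<rho>) ^ k)"
    define D where "D N = (\<Sum>a\<in>?A. 1 - measure_pmf.expectation p (\<lambda>y. hit_prob p ?A N (a + y)))" for N
    have R: "0 \<le> R" unfolding R_def using \<rho> by (intro sum_nonneg) auto
    have finite_time: "2 ^ n \<le> C * R * D N" for N
    proof -
      define u where "u = hit_prob p ?A N"
      have bounds: "0 \<le> u x" "u x \<le> 1" for x
        using hit_prob_bounds[of p ?A N x] by (auto simp: u_def)
      have one: "u a = 1" if "a \<in> ?A" for a using that by (simp add: u_def hit_prob_on)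
      have fin: "nn_sum (\<lambda>x. ennreal (u x)) < \<top>"
        unfolding u_def by (rule nn_sum_hit_prob_finite) simp
      have sub: "u x \<le> measure_pmf.expectation p (\<lambda>y. u (x + y))" if "x \<notin> ?A" for x
        using hit_prob_mono_Suc[of p ?A N x] that by (simp add: u_def)
      have energy: "(\<Sum>x\<in>F. \<Sum>y\<in>F. pmf p (y - x) * (u x - u y)\<^sup>2) \<le> 2 * D N"
        if "finite F" for F
        using dirichlet_form_le_of_subharmonic_off[OF bounds fin finite_cantor_set one sub that]
        by (simp only: D_def u_def)
      have bound: "2 ^ n * (1 - block_mean u K 0)\<^sup>2 \<le> C * R * D N" if "n \<le> K" for K
      proof -
        let ?F = "{0..<3 ^ K} :: int set"
        let ?kernel = "\<lambda>x y. \<Sum>k<K. if x div 3 ^ Suc k = y div 3 ^ Suc k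
            then 1 / (\<rho> ^ k * (3 ^ k * 3 ^ Suc k)) else 0"
        let ?S = "\<Sum>k<K. 2 ^ min k n * \<rho> ^ k"
        have S: "0 \<le> ?S" "?S \<le> R / (1 - \<rho>)"
          using \<rho> sum_two_power_min_le[OF \<rho> that] by (auto simp: R_def intro!: sum_nonneg)
        have kernel: "(u x - u y)\<^sup>2 * ?kernel x y \<le> 9 / c\<^sub>0 * (pmf p (y - x) * (u x - u y)\<^sup>2)" for x y
        \<comment> \<open>The diagonal carries no energy, so the lower bound on the step law away
          from 0 suffices.\<close>
        proof (cases "x = y")
          case False
          have "?kernel x y \<le> 9 * \<bar>real_of_int (y - x)\<bar> powr (- 1 - \<alpha>)"
            unfolding \<rho>_def by (rule weighted_triadic_kernel_sum_le[OF \<alpha> False])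
          also have "\<dots> \<le> 9 / c\<^sub>0 * pmf p (y - x)"
            using p_ge[of "y - x"] False c0 by (simp add: field_simps)
          finally have "(u x - u y)\<^sup>2 * ?kernel x y \<le> (u x - u y)\<^sup>2 * (9 / c\<^sub>0 * pmf p (y - x))"
            by (rule mult_left_mono) simp
          then show ?thesis by (simp only: mult_ac)
        qed simp
        have "2 ^ n * (1 - block_mean u K 0)\<^sup>2 \<le> ?S * (\<Sum>x\<in>?F. \<Sum>y\<in>?F. (u x - u y)\<^sup>2 * ?kernel x y)"
          by (rule cantor_set_block_energy_lower_bound[OF one that \<rho>(1)])
        also have "\<dots> \<le> ?S * (\<Sum>x\<in>?F. \<Sum>y\<in>?F. 9 / c\<^sub>0 * (pmf p (y - x) * (u x - u y)\<^sup>2))"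
          by (intro mult_left_mono sum_mono kernel S)
        also have "\<dots> = ?S * (9 / c\<^sub>0 * (\<Sum>x\<in>?F. \<Sum>y\<in>?F. pmf p (y - x) * (u x - u y)\<^sup>2))"
          by (simp only: sum_distrib_left)
        also have "\<dots> \<le> R / (1 - \<rho>) * (9 / c\<^sub>0 * (2 * D N))"
        proof (rule mult_mono)
          have pos: "0 \<le> (\<Sum>x\<in>?F. \<Sum>y\<in>?F. pmf p (y - x) * (u x - u y)\<^sup>2)"
            by (intro sum_nonneg mult_nonneg_nonneg) auto
          show "0 \<le> 9 / c\<^sub>0 * (\<Sum>x\<in>?F. \<Sum>y\<in>?F. pmf p (y - x) * (u x - u y)\<^sup>2)"
            by (rule mult_nonneg_nonneg[OF _ pos]) (use c0 in simp)
          show "9 / c\<^sub>0 * (\<Sum>x\<in>?F. \<Sum>y\<in>?F. pmf p (y - x) * (u x - u y)\<^sup>2) \<le> 9 / c\<^sub>0 * (2 * D N)"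
            using c0 by (intro mult_left_mono energy) auto
        qed (use R \<rho> S in auto)
        also have "\<dots> = C * R * D N"
          by (simp add: C_def mult_ac)
        finally show ?thesis .
      qed
      have "(\<lambda>K. 2 ^ n * (1 - block_mean u K 0)\<^sup>2) \<longlonglongrightarrow> 2 ^ n * (1 - 0)\<^sup>2"
        by (intro tendsto_intros block_mean_tendsto_0 bounds fin)
      then have "2 ^ n * (1 - 0)\<^sup>2 \<le> C * R * D N"
        by (rule LIMSEQ_le_const2) (use bound in auto)
      then show ?thesis by simp
    qed
    have "D \<longlonglongrightarrow> walk_capacity p ?A"
      unfolding D_def walk_capacity_def by (intro tendsto_sum escape_prob_limit)
    then have "(\<lambda>N. C * R * D N) \<longlonglongrightarrow> C * R * walk_capacity p ?A"
      by (intro tendsto_mult_left)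
    then have "2 ^ n \<le> C * R * walk_capacity p ?A"
      by (rule LIMSEQ_le_const) (use finite_time in auto)
    then show ?thesis by (simp add: R_def)
  qed
  with C show ?thesis unfolding \<rho>_def by (rule that)
qed

section \<open>From the geometric sum to the two capacity bounds\<close>

theorem theorem9:
  fixes \<alpha> :: real and p :: "int pmf"
  assumes "alpha_walk \<alpha> p"
  shows "(\<exists>c>0. \<forall>n\<ge>1. walk_capacity p (cantor_set n) \<ge>
            c / real n * min (2 ^ n) (3 powr (real n * (1 - \<alpha>)))) \<and>
         (\<alpha> \<noteq> 1 - log 3 2 \<longrightarrow>
          (\<exists>c>0. \<forall>n\<ge>1. walk_capacity p (cantor_set n) \<ge>
            c * min (2 ^ n) (3 powr (real n * (1 - \<alpha>)))))"
proof -
  define r :: real where "r = 2 * 3 powr (\<alpha> - 1)"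
  define m where "m n = min (2 ^ n) (3 powr (real n * (1 - \<alpha>)))" for n
  define cap where "cap n = walk_capacity p (cantor_set n)" for n
  have r: "0 < r" by (simp add: r_def)
  obtain C where C: "0 < C" and cap: "\<And>n. 2 ^ n \<le> C * (\<Sum>k\<le>n. r ^ k) * cap n"
    using walk_capacity_cantor_set_lower_bound[OF assms] unfolding r_def cap_def by blast
  \<comment> \<open>As \<open>r ^ n * 3 powr (real n * (1 - \<alpha>)) = 2 ^ n\<close>, the minimum
    is \<open>2 ^ n\<close> divided by the larger of the two end terms 1 and \<open>r ^ n\<close> of
    the geometric sum.\<close>
  have m_eq: "m n * max 1 (r ^ n) = 2 ^ n" for n
  proof -
    define q :: real where "q = 3 powr (real n * (1 - \<alpha>))"
    have q: "0 < q" by (simp add: q_def)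
    have "r ^ n * q = 2 ^ n * (3 powr (real n * (\<alpha> - 1)) * q)"
      by (simp add: r_def power_mult_distrib powr_power mult.commute)
    also have "3 powr (real n * (\<alpha> - 1)) * q = 1"
      unfolding q_def powr_add[symmetric] by (simp add: algebra_simps)
    finally have eq: "q * r ^ n = 2 ^ n" by (simp add: mult.commute)
    show ?thesis
    proof (cases "1 \<le> r ^ n")
      case True
      then have "q * 1 \<le> 2 ^ n" unfolding eq[symmetric] using q by (intro mult_left_mono) auto
      with True show ?thesis using eq by (simp add: m_def q_def[symmetric] max_def)
    next
      case False
      then have "2 ^ n \<le> q * 1" unfolding eq[symmetric] using q by (intro mult_left_mono) auto
      with False show ?thesis by (simp add: m_def q_def[symmetric] max_def)
    qed
  qed
  \<comment> \<open>Both claims thus reduce to comparing the geometric sum with its larger end term.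
    Positivity of the capacity lets the sum be replaced by its upper bound.\<close>
  have bound: "cap n \<ge> 1 / (C * B) * m n" if "0 < B" "(\<Sum>k\<le>n. r ^ k) \<le> B * max 1 (r ^ n)" for n B
  proof -
    have sum: "0 < (\<Sum>k\<le>n. r ^ k)" using r by (intro sum_pos) auto
    have cap_pos: "0 < cap n"
      using cap[of n] C sum by (smt (verit) mult_nonneg_nonpos zero_less_power mult_pos_pos)
    have "m n * max 1 (r ^ n) \<le> C * (\<Sum>k\<le>n. r ^ k) * cap n"
      unfolding m_eq by (rule cap)
    also have "\<dots> \<le> C * (B * max 1 (r ^ n)) * cap n"
      using that C cap_pos by (intro mult_right_mono mult_left_mono) auto
    finally have "m n * max 1 (r ^ n) \<le> C * B * cap n * max 1 (r ^ n)"
      by (simp only: mult_ac)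
    then have "m n \<le> C * B * cap n"
      by (rule mult_right_le_imp_le) simp
    then show ?thesis using C that by (simp add: field_simps)
  qed
  \<comment> \<open>Powers of \<open>r\<close> are largest at an end of the range, so the
    \<open>n + 1\<close> terms cost a factor \<open>n + 1 \<le> 2 * n\<close>, using
    \<open>1 \<le> n\<close>.\<close>
  have "cap n \<ge> 1 / (2 * C) / real n * m n" if "1 \<le> n" for n
  proof -
    have "(\<Sum>k\<le>n. r ^ k) \<le> (\<Sum>k\<le>n. max 1 (r ^ n))"
    proof (rule sum_mono)
      fix k assume "k \<in> {..n}"
      then show "r ^ k \<le> max 1 (r ^ n)"
        using r by (cases "r \<le> 1") (auto simp: power_le_one le_max_iff_disj intro: power_increasing)
    qed
    also have "\<dots> = (real n + 1) * max 1 (r ^ n)" by simp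
    also have "\<dots> \<le> (2 * real n) * max 1 (r ^ n)" using that by (intro mult_right_mono) auto
    finally show ?thesis using bound[of "2 * real n" n] that by (simp add: mult_ac)
  qed
  then have part1: "\<exists>c>0. \<forall>n\<ge>1. cap n \<ge> c / real n * m n"
    using C by (intro exI[of _ "1 / (2 * C)"]) auto
  have part2: "\<exists>c>0. \<forall>n\<ge>1. cap n \<ge> c * m n" if "\<alpha> \<noteq> 1 - log 3 2"
  proof -
    have "r \<noteq> 1"
    proof
      assume "r = 1"
      then have "log 3 2 + log 3 (3 powr (\<alpha> - 1)) = log 3 1"
        unfolding r_def by (subst log_mult_pos[symmetric]) auto
      with that show False by simp
    qed
    \<comment> \<open>One constant for both regimes: it is \<open>1 / (1 - r)\<close> for
      \<open>r < 1\<close> and \<open>r / (r - 1)\<close> for \<open>r > 1\<close>, the factor by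
      which the full geometric sum can exceed its larger end term.\<close>
    define B where "B = max 1 r / \<bar>1 - r\<bar>"
    have B: "0 < B" using \<open>r \<noteq> 1\<close> by (simp add: B_def)
    have "(\<Sum>k\<le>n. r ^ k) \<le> B * max 1 (r ^ n)" for n
    proof (cases "r < 1")
      case True
      have "(\<Sum>k\<le>n. r ^ k) = (1 - r ^ Suc n) / (1 - r)"
        using True by (simp add: sum_gp0)
      also have "\<dots> \<le> 1 / (1 - r)" using True r by (intro divide_right_mono) auto
      also have "\<dots> \<le> B * max 1 (r ^ n)"
        using True r by (simp add: B_def max_absorb1 power_le_one)
      finally show ?thesis .
    next
      case False
      with \<open>r \<noteq> 1\<close> have r1: "1 < r" by simp
      have "(\<Sum>k\<le>n. r ^ k) = (r ^ Suc n - 1) / (r - 1)"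
        using r1 by (simp add: sum_gp0 field_simps)
      also have "\<dots> \<le> r ^ Suc n / (r - 1)" using r1 by (intro divide_right_mono) auto
      also have "\<dots> = B * max 1 (r ^ n)"
        using r1 by (simp add: B_def max_absorb2 less_imp_le)
      finally show ?thesis .
    qed
    then show ?thesis using bound[OF B] B C by (intro exI[of _ "1 / (C * B)"]) auto
  qed
  show ?thesis using part1 part2 unfolding cap_def m_def by blast
qed

end
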